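(* Let $\tau>0$ and $S_\tau=\mathrm{diag}\bigl(\sqrt{\coth\tau},\sqrt{\tanh\tau}\bigr)\in\mathrm{Sp}(2,\mathbb{R})$. Then $$C_{\mathrm{BF}}(\tau):=|\langle\Omega,\mu(S_\tau)\Omega\rangle|=(1-e^{-4\tau})^{1/4}=(2\sinh2\tau)^{1/4}e^{-\tau/2}.$$ In the holomorphic Bargmann--Fock space $\mathcal{F}$ the corresponding normalized Gaussian vector (the image of $\mu(S_\tau)\Omega$ under the Bargmann transform, up to phase) is $$\psi_\tau(z)=(1-b_\tau^2)^{1/4}\exp\Bigl(\frac{b_\tau}2z^2\Bigr),\qquad b_\tau=\frac{\coth\tau-1}{\coth\tau+1}=e^{-2\tau},$$ and $|\langle1,\psi_\tau\rangle_{\mathcal{F}}|=C_{\mathrm{BF}}(\tau)$.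
   Context: $\Omega(x)=\pi^{-1/4}e^{-x^2/2}$ is the normalized Gaussian in $L^2(\mathbb{R})$, and $\mu$ is the metaplectic representation; for $a>0$ and $S_a=\mathrm{diag}(a,a^{-1})$ it is given, up to a unimodular phase, by $(\mu(S_a)f)(x)=a^{-1/2}f(x/a)$. The Bargmann--Fock space is $$\mathcal{F}=\Bigl\{f\text{ entire on }\mathbb{C}:\ \|f\|_{\mathcal{F}}^2=\pi^{-1}\int_{\mathbb{C}}|f(z)|^2e^{-|z|^2}\,dL(z)<\infty\Bigr\},$$ with $dL$ Lebesgue measure. The Bargmann transform is the unitary $L^2(\mathbb{R})\to\mathcal{F}$, $(Bf)(z)=\pi^{-1/4}\int_{\mathbb{R}}e^{-z^2/2+\sqrt2xz-x^2/2}f(x)\,dx$, which carries $\Omega$ to the constant function $1$. *)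

theory Defs
  imports "HOL-Analysis.Analysis"
begin

section \<open>The space \<open>L\<^sup>2(\<real>)\<close>\<close>

text \<open>
  Elements of \<open>L\<^sup>2(\<real>)\<close> are represented by functions; equality in \<open>L\<^sup>2(\<real>)\<close> is equality
  almost everywhere, and is always written out as such.
\<close>

definition L2 :: "(real \<Rightarrow> complex) set" where
  "L2 = {f \<in> borel_measurable lborel. integrable lborel (\<lambda>x. (cmod (f x))\<^sup>2)}"

definition L2_inner :: "(real \<Rightarrow> complex) \<Rightarrow> (real \<Rightarrow> complex) \<Rightarrow> complex" where
  "L2_inner f g = (LINT x|lborel. f x * cnj (g x))"

text \<open>
  Linearity and preservation of the inner product force an operator to respect equality almost
  everywhere, so this is a property of the induced operator on equivalence classes.
\<close>

definition unitary_L2 :: "((real \<Rightarrow> complex) \<Rightarrow> (real \<Rightarrow> complex)) \<Rightarrow> bool" where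
  "unitary_L2 U \<longleftrightarrow>
     (\<forall>f\<in>L2. U f \<in> L2) \<and>
     (\<forall>f\<in>L2. \<forall>g\<in>L2. \<forall>c d. AE x in lborel. U (\<lambda>t. c * f t + d * g t) x = c * U f x + d * U g x) \<and>
     (\<forall>f\<in>L2. \<forall>g\<in>L2. L2_inner (U f) (U g) = L2_inner f g) \<and>
     (\<forall>g\<in>L2. \<exists>f\<in>L2. AE x in lborel. U f x = g x)"

definition gauss :: "real \<Rightarrow> complex" where
  "gauss x = of_real (pi powr (-1/4) * exp (- x\<^sup>2 / 2))"


section \<open>Symplectic matrices and metaplectic operators\<close>

definition diag2 :: "real \<Rightarrow> real \<Rightarrow> real^2^2" where
  "diag2 a d = vector [vector [a, 0], vector [0, d]]"

definition Sp2 :: "(real^2^2) set" where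
  "Sp2 = (let J = vector [vector [0, 1], vector [-1, 0]] in {A. transpose A ** J ** A = J})"

text \<open>
  The Weyl operator \<open>exp (i (p X - q P))\<close> for \<open>w = (q, p)\<close>, with \<open>X\<close> multiplication by \<open>x\<close> and
  \<open>P = -i d/dx\<close>. The symmetric phase makes the cocycle depend only on the symplectic form, so that
  \<open>Sp(2,\<real>)\<close> acts by automorphisms.
\<close>

definition weyl :: "real^2 \<Rightarrow> (real \<Rightarrow> complex) \<Rightarrow> (real \<Rightarrow> complex)" where
  "weyl w f = (\<lambda>x. cis (w $ 2 * (x - w $ 1 / 2)) * f (x - w $ 1))"

text \<open>
  \<open>metaplectic S U\<close> says that \<open>U\<close> is a value of the metaplectic representation at \<open>S\<close>, that is, a
  unitary operator with \<open>U \<rho>(w) U\<^sup>-\<^sup>1 = \<rho>(S w)\<close> for the Weyl operators \<open>\<rho>\<close>. By irreducibility of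
  \<open>\<rho>\<close> this determines \<open>U\<close> up to a unimodular phase.
\<close>

definition metaplectic :: "real^2^2 \<Rightarrow> ((real \<Rightarrow> complex) \<Rightarrow> (real \<Rightarrow> complex)) \<Rightarrow> bool" where
  "metaplectic S U \<longleftrightarrow> unitary_L2 U \<and>
     (\<forall>w. \<forall>f\<in>L2. AE x in lborel. U (weyl w f) x = weyl (S *v w) (U f) x)"

text \<open>For \<open>S = diag(a, 1/a)\<close> the dilations, with an arbitrary phase, are metaplectic operators.\<close>

lemma L2_dilation:
  assumes "a > 0" "f \<in> L2"
  shows "(\<lambda>x. c * f (x / a)) \<in> L2"
proof -
  have "integrable lborel (\<lambda>x. (cmod (f (0 + inverse a * x)))\<^sup>2)"
    using assms by (intro lborel_integrable_real_affine) (auto simp: L2_def)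
  then have "integrable lborel (\<lambda>x. (cmod c)\<^sup>2 * (cmod (f (x / a)))\<^sup>2)"
    by (intro integrable_mult_right) (simp add: field_simps)
  moreover have [measurable]: "f \<in> borel_measurable borel"
    using assms by (simp add: L2_def)
  ultimately show ?thesis
    by (simp add: L2_def norm_mult power_mult_distrib)
qed

lemma metaplectic_dilation:
  assumes a: "a > 0" and c: "cmod c = 1"
  shows "metaplectic (diag2 a (inverse a)) (\<lambda>f x. c * of_real (a powr (-1/2)) * f (x / a))"
proof -
  define k where "k = c * of_real (a powr (-1/2))"
  have c1: "c * cnj c = 1"
    using c complex_norm_square [of c] by simp
  have "a powr (-1/2) * a powr (-1/2) = inverse a"
    using a powr_add [of a "-1/2" "-1/2"] powr_minus [of a 1] by simp
  then have "complex_of_real (a powr (-1/2)) * of_real (a powr (-1/2)) = of_real (inverse a)"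
    by (metis of_real_mult)
  then have kk: "k * cnj k = of_real (inverse a)"
    using c1 by (simp add: k_def mult.commute mult.left_commute)
  have k0: "k \<noteq> 0"
    using kk a by auto
  have inner: "L2_inner (\<lambda>x. k * f (x / a)) (\<lambda>x. k * g (x / a)) = L2_inner f g" for f g
  proof -
    have "L2_inner (\<lambda>x. k * f (x / a)) (\<lambda>x. k * g (x / a))
        = \<bar>a\<bar> *\<^sub>R (LINT x|lborel. k * f ((0 + a * x) / a) * cnj (k * g ((0 + a * x) / a)))"
      unfolding L2_inner_def using a by (intro lborel_integral_real_affine) simp
    also have "\<dots> = of_real a * (LINT x|lborel. k * cnj k * (f x * cnj (g x)))"
      using a by (simp add: scaleR_conv_of_real algebra_simps)
    also have "\<dots> = L2_inner f g"
      unfolding kk L2_inner_def using a by simp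
    finally show ?thesis .
  qed
  have surj: "\<exists>f\<in>L2. AE x in lborel. k * f (x / a) = g x" if "g \<in> L2" for g
  proof
    show "(\<lambda>x. inverse k * g (x / inverse a)) \<in> L2"
      using a that by (intro L2_dilation) auto
    show "AE x in lborel. k * (inverse k * g (x / a / inverse a)) = g x"
      using a k0 by simp
  qed
  have S: "(diag2 a (inverse a) *v w) $ 1 = a * w $ 1"
    "(diag2 a (inverse a) *v w) $ 2 = w $ 2 / a" for w
    by (simp_all add: diag2_def matrix_vector_mult_def sum_2 vector_2 divide_inverse_commute)
  have weyl: "k * weyl w f (x / a) = weyl (diag2 a (inverse a) *v w) (\<lambda>x. k * f (x / a)) x" for w f x
  proof -
    have "w $ 2 * (x / a - w $ 1 / 2) = w $ 2 / a * (x - a * w $ 1 / 2)"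
      "x / a - w $ 1 = (x - a * w $ 1) / a"
      using a by (simp_all add: field_simps)
    then show ?thesis
      by (simp add: weyl_def S)
  qed
  have "AE x in lborel. k * (c * f (x / a) + d * g (x / a)) = c * (k * f (x / a)) + d * (k * g (x / a))"
    for c d f g
    by (simp add: algebra_simps)
  then have "metaplectic (diag2 a (inverse a)) (\<lambda>f x. k * f (x / a))"
    unfolding metaplectic_def unitary_L2_def
    using inner surj L2_dilation [OF a] weyl by simp
  then show ?thesis
    by (simp add: k_def)
qed


section \<open>The Bargmann--Fock space\<close>

definition Fock :: "(complex \<Rightarrow> complex) set" where
  "Fock = {f. f holomorphic_on UNIV \<and> integrable lborel (\<lambda>z. (cmod (f z))\<^sup>2 * exp (- (cmod z)\<^sup>2))}"

definition Fock_inner :: "(complex \<Rightarrow> complex) \<Rightarrow> (complex \<Rightarrow> complex) \<Rightarrow> complex" where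
  "Fock_inner f g = (LINT z|lborel. f z * cnj (g z) * of_real (exp (- (cmod z)\<^sup>2))) / of_real pi"

definition Fock_norm :: "(complex \<Rightarrow> complex) \<Rightarrow> real" where
  "Fock_norm f = sqrt ((LINT z|lborel. (cmod (f z))\<^sup>2 * exp (- (cmod z)\<^sup>2)) / pi)"

definition bargmann :: "(real \<Rightarrow> complex) \<Rightarrow> (complex \<Rightarrow> complex)" where
  "bargmann f z = of_real (pi powr (-1/4)) *
     (LINT x|lborel. exp (- z\<^sup>2 / 2 + of_real (sqrt 2 * x) * z - of_real (x\<^sup>2 / 2)) * f x)"


section \<open>The squeezed Gaussian\<close>

definition coth :: "real \<Rightarrow> real" where
  "coth x = cosh x / sinh x"

definition S_mat :: "real \<Rightarrow> real^2^2" where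
  "S_mat \<tau> = diag2 (sqrt (coth \<tau>)) (sqrt (tanh \<tau>))"

definition b_par :: "real \<Rightarrow> real" where
  "b_par \<tau> = (coth \<tau> - 1) / (coth \<tau> + 1)"

definition psi :: "real \<Rightarrow> complex \<Rightarrow> complex" where
  "psi \<tau> z = of_real ((1 - (b_par \<tau>)\<^sup>2) powr (1/4)) * exp (of_real (b_par \<tau> / 2) * z\<^sup>2)"

text \<open>
  The argument \<open>U\<close> stands for \<open>\<mu>(S\<^sub>\<tau>)\<close>; the modulus removes the phase ambiguity of \<open>\<mu>\<close>.
\<close>

definition C_BF :: "((real \<Rightarrow> complex) \<Rightarrow> (real \<Rightarrow> complex)) \<Rightarrow> real" where
  "C_BF U = cmod (L2_inner gauss (U gauss))"

end

theory Submission
  imports Defs "HOL-Probability.Probability"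
begin

text \<open>
  Two metaplectic operators \<open>U\<close>, \<open>V\<close> over the same \<open>S\<close> satisfy
  \<open>\<langle>U f, \<rho>(S w) U f\<rangle> = \<langle>f, \<rho>(w) f\<rangle> = \<langle>V f, \<rho>(S w) V f\<rangle>\<close>. Since the matrix coefficients of the
  Weyl operators determine a vector up to a phase, which follows from uniqueness of the Fourier
  transform, \<open>\<mu>(S\<^sub>\<tau>)\<Omega>\<close> is a phase times the Gaussian dilated by \<open>a = sqrt (coth \<tau>)\<close>. What remains are
  Gaussian integrals with quadratic exponents, over \<open>\<real>\<close> and, iterated, over \<open>\<complex>\<close>.
\<close>

section \<open>Weyl coefficients and uniqueness of metaplectic operators\<close>

lemma borel_measurable_cnj [measurable (raw)]:
  assumes "f \<in> borel_measurable M"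
  shows "(\<lambda>x. cnj (f x)) \<in> borel_measurable M"
  using assms by (rule measurable_compose) (intro borel_measurable_continuous_onI continuous_intros)

lemma integrable_iexp_times:
  fixes f :: "real \<Rightarrow> complex"
  assumes "integrable lborel f"
  shows "integrable lborel (\<lambda>x. iexp (t * x) * f x)"
proof (rule Bochner_Integration.integrable_bound [OF assms])
  have [measurable]: "f \<in> borel_measurable borel"
    using borel_measurable_integrable [OF assms] by simp
  show "(\<lambda>x. iexp (t * x) * f x) \<in> borel_measurable lborel"
    by measurable
qed (simp add: norm_mult)

text \<open>Split \<open>f\<close> into its positive and negative parts, which have the same Fourier
  transform. Frequency 0 shows that they have the same mass \<open>m\<close>. If \<open>m\<close> is
  positive, dividing by it gives two probability densities with equal characteristic functions, and
  Levy's uniqueness theorem identifies them.\<close>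

lemma Fourier_eq_0_imp_AE_eq_0_real:
  fixes f :: "real \<Rightarrow> real"
  assumes f: "integrable lborel f"
    and F: "\<And>t. (LINT x|lborel. iexp (t * x) * of_real (f x)) = 0"
  shows "AE x in lborel. f x = 0"
proof -
  define p n where "p = (\<lambda>x. max 0 (f x))" and "n = (\<lambda>x. max 0 (- f x))"
  have fm [measurable]: "f \<in> borel_measurable borel"
    using borel_measurable_integrable [OF f] by simp
  have [measurable]: "p \<in> borel_measurable borel" "n \<in> borel_measurable borel"
    by (simp_all add: p_def n_def)
  have p: "integrable lborel p" and n: "integrable lborel n"
    using f by (simp_all add: p_def n_def)
  have p0: "0 \<le> p x" and n0: "0 \<le> n x" and fpn: "f x = p x - n x" for x
    by (auto simp: p_def n_def)
  define m where "m = (LINT x|lborel. p x)"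
  have eq: "(LINT x|lborel. iexp (t * x) * of_real (p x)) = (LINT x|lborel. iexp (t * x) * of_real (n x))" for t
  proof -
    have "0 = (LINT x|lborel. iexp (t * x) * of_real (p x) - iexp (t * x) * of_real (n x))"
      using F [of t] by (simp add: fpn algebra_simps)
    also have "\<dots> = (LINT x|lborel. iexp (t * x) * of_real (p x)) - (LINT x|lborel. iexp (t * x) * of_real (n x))"
      by (intro Bochner_Integration.integral_diff integrable_iexp_times integrable_of_real p n)
    finally show ?thesis by simp
  qed
  have mn: "m = (LINT x|lborel. n x)"
    using eq [of 0] by (simp add: m_def)
  have m0: "m \<ge> 0"
    by (simp add: m_def p0)
  show ?thesis
  \<comment> \<open>With \<open>m = 0\<close> normalization is impossible, but then both parts
    vanish almost everywhere.\<close>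
  proof (cases "m = 0")
    case True
    have "AE x in lborel. p x = 0" "AE x in lborel. n x = 0"
      using True mn integral_nonneg_eq_0_iff_AE [OF p] integral_nonneg_eq_0_iff_AE [OF n]
      by (simp_all add: m_def p0 n0)
    then show ?thesis
      by eventually_elim (simp add: fpn)
  next
    case False
    with m0 have m: "m > 0" by simp
    \<comment> \<open>Stated for a generic nonnegative \<open>g\<close> of mass \<open>m\<close>, to
      be used for both \<open>p\<close> and \<open>n\<close>.\<close>
    have dist: "real_distribution (density lborel (\<lambda>x. ennreal (g x / m)))"
      and char: "char (density lborel (\<lambda>x. ennreal (g x / m))) t
        = (LINT x|lborel. iexp (t * x) * of_real (g x)) / of_real m"
      if [measurable]: "g \<in> borel_measurable borel" and g: "integrable lborel g" and "\<And>x. 0 \<le> g x" "m = (LINT x|lborel. g x)" for g t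
    proof -
      have "integrable lborel (\<lambda>x. g x / m)" "(LINT x|lborel. g x / m) = 1"
        using g that m by simp_all
      then have "(\<integral>\<^sup>+x. ennreal (g x / m) \<partial>lborel) = 1"
        using m that by (subst nn_integral_eq_integral) auto
      then have "prob_space (density lborel (\<lambda>x. ennreal (g x / m)))"
        by (intro prob_spaceI) (simp add: emeasure_density)
      then show "real_distribution (density lborel (\<lambda>x. ennreal (g x / m)))"
        by (simp add: real_distribution_def real_distribution_axioms_def)
      have "char (density lborel (\<lambda>x. ennreal (g x / m))) t
          = (LINT x|lborel. (g x / m) *\<^sub>R iexp (t * x))"
        unfolding char_def using m that by (intro integral_density) auto
      also have "\<dots> = (LINT x|lborel. iexp (t * x) * of_real (g x) / of_real m)"
        by (simp add: scaleR_conv_of_real mult.commute)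
      finally show "char (density lborel (\<lambda>x. ennreal (g x / m))) t
        = (LINT x|lborel. iexp (t * x) * of_real (g x)) / of_real m"
        by simp
    qed
    have "density lborel (\<lambda>x. ennreal (p x / m)) = density lborel (\<lambda>x. ennreal (n x / m))"
    proof (rule Levy_uniqueness)
      show "char (density lborel (\<lambda>x. ennreal (p x / m))) = char (density lborel (\<lambda>x. ennreal (n x / m)))"
      proof
        fix t
        have "char (density lborel (\<lambda>x. ennreal (p x / m))) t = (LINT x|lborel. iexp (t * x) * of_real (p x)) / of_real m"
          by (rule char) (use p p0 m_def in auto)
        moreover have "char (density lborel (\<lambda>x. ennreal (n x / m))) t = (LINT x|lborel. iexp (t * x) * of_real (n x)) / of_real m"
          by (rule char) (use n n0 mn in auto)
        ultimately show "char (density lborel (\<lambda>x. ennreal (p x / m))) t = char (density lborel (\<lambda>x. ennreal (n x / m))) t"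
          using eq [of t] by simp
      qed
    qed (intro dist; use p n p0 n0 mn m_def in auto)+
    then have "AE x in lborel. ennreal (p x / m) = ennreal (n x / m)"
      by (intro sigma_finite_measure.density_unique [OF sigma_finite_lborel]) auto
    then show ?thesis
      by eventually_elim (use m p0 n0 in \<open>simp add: fpn divide_nonneg_pos\<close>)
  qed
qed

text \<open>Conjugation turns frequency \<open>t\<close> into \<open>- t\<close>, so the transform
  of \<open>cnj f\<close> vanishes as well. Real and imaginary parts are linear combinations of
  \<open>f\<close> and \<open>cnj f\<close>, which reduces the claim to real functions.\<close>

lemma Fourier_eq_0_imp_AE_eq_0:
  fixes f :: "real \<Rightarrow> complex"
  assumes f: "integrable lborel f"
    and F: "\<And>t. (LINT x|lborel. iexp (t * x) * f x) = 0"
  shows "AE x in lborel. f x = 0"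
proof -
  have int: "integrable lborel (\<lambda>x. iexp (t * x) * f x)" for t
    by (rule integrable_iexp_times [OF f])
  have intc: "integrable lborel (\<lambda>x. iexp (t * x) * cnj (f x))" for t
    by (rule integrable_iexp_times) (use f in simp)
  have Fc: "(LINT x|lborel. iexp (t * x) * cnj (f x)) = 0" for t
  proof -
    have "(LINT x|lborel. iexp (t * x) * cnj (f x)) = cnj (LINT x|lborel. iexp (- t * x) * f x)"
      by (subst Bochner_Integration.integral_cnj [symmetric]) (simp add: exp_cnj)
    then show ?thesis using F [of "- t"] by simp
  qed
  have "AE x in lborel. Re (f x) = 0"
  proof (rule Fourier_eq_0_imp_AE_eq_0_real)
    fix t
    have "(LINT x|lborel. iexp (t * x) * of_real (Re (f x)))
        = (LINT x|lborel. (iexp (t * x) * f x + iexp (t * x) * cnj (f x)) / 2)"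
      by (simp add: complex_add_cnj flip: distrib_left)
    then show "(LINT x|lborel. iexp (t * x) * of_real (Re (f x))) = 0"
      using int intc F Fc by simp
  qed (use f in simp)
  moreover have "AE x in lborel. Im (f x) = 0"
  proof (rule Fourier_eq_0_imp_AE_eq_0_real)
    fix t
    have "(LINT x|lborel. iexp (t * x) * of_real (Im (f x)))
        = (LINT x|lborel. (iexp (t * x) * f x - iexp (t * x) * cnj (f x)) / (2 * \<i>))"
      unfolding right_diff_distrib [symmetric] complex_diff_cnj
      by (intro Bochner_Integration.integral_cong refl) (simp add: field_simps)
    then show "(LINT x|lborel. iexp (t * x) * of_real (Im (f x))) = 0"
      using int intc F Fc by simp
  qed (use f in simp)
  ultimately show ?thesis
    by eventually_elim (simp add: complex_eq_iff)
qed

section \<open>Square-integrable functions, Weyl operators and their matrix coefficients\<close>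

lemma L2_times_cnj_integrable:
  assumes "f \<in> L2" "g \<in> L2"
  shows "integrable lborel (\<lambda>x. f x * cnj (g x))"
proof (rule Bochner_Integration.integrable_bound)
  show "integrable lborel (\<lambda>x. (cmod (f x))\<^sup>2 + (cmod (g x))\<^sup>2)"
    using assms by (simp add: L2_def)
  have [measurable]: "f \<in> borel_measurable borel" "g \<in> borel_measurable borel"
    using assms by (simp_all add: L2_def)
  show "(\<lambda>x. f x * cnj (g x)) \<in> borel_measurable lborel"
    by measurable
  show "AE x in lborel. norm (f x * cnj (g x)) \<le> norm ((cmod (f x))\<^sup>2 + (cmod (g x))\<^sup>2)"
  proof (intro always_eventually allI)
    fix x
    have "2 * cmod (f x) * cmod (g x) \<le> (cmod (f x))\<^sup>2 + (cmod (g x))\<^sup>2"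
      by (rule sum_squares_bound)
    moreover have "0 \<le> cmod (f x) * cmod (g x)"
      by simp
    ultimately show "norm (f x * cnj (g x)) \<le> norm ((cmod (f x))\<^sup>2 + (cmod (g x))\<^sup>2)"
      unfolding norm_mult complex_mod_cnj real_norm_def by linarith
  qed
qed

text \<open>Metaplectic operators satisfy the intertwining relation only almost everywhere, so inner
  products have to be rewritten modulo null sets. Membership in \<open>L2\<close> supplies the
  measurability of the integrands.\<close>

lemma L2_inner_cong_AE:
  assumes "f \<in> L2" "f' \<in> L2" "g \<in> L2" "g' \<in> L2"
    and "AE x in lborel. f x = f' x" "AE x in lborel. g x = g' x"
  shows "L2_inner f g = L2_inner f' g'"
  unfolding L2_inner_def
proof (rule integral_cong_AE)
  show "AE x in lborel. f x * cnj (g x) = f' x * cnj (g' x)"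
    using assms(5,6) by eventually_elim simp
qed (use L2_times_cnj_integrable assms(1-4) in \<open>auto dest: borel_measurable_integrable\<close>)

lemma L2_inner_self:
  "L2_inner f f = of_real (LINT x|lborel. (cmod (f x))\<^sup>2)"
  unfolding L2_inner_def complex_norm_square [symmetric] of_real_power [symmetric]
  by (rule integral_complex_of_real)

lemma L2_translate:
  assumes "f \<in> L2"
  shows "(\<lambda>x. f (x - q)) \<in> L2"
proof -
  have [measurable]: "f \<in> borel_measurable borel"
    using assms by (simp add: L2_def)
  have "integrable lborel (\<lambda>x. (cmod (f (- q + 1 * x)))\<^sup>2)"
    using assms by (intro lborel_integrable_real_affine) (auto simp: L2_def)
  then show ?thesis
    by (simp add: L2_def)
qed

lemma weyl_L2:
  assumes "f \<in> L2"
  shows "weyl w f \<in> L2"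
proof -
  have "(\<lambda>x. f (x - w $ 1)) \<in> L2"
    by (rule L2_translate) fact
  moreover have [measurable]: "f \<in> borel_measurable borel"
    using assms by (simp add: L2_def)
  have "(\<lambda>x. cis (w $ 2 * (x - w $ 1 / 2)) * f (x - w $ 1)) \<in> borel_measurable borel"
    unfolding cis_conv_exp by measurable
  ultimately show ?thesis
    by (simp add: L2_def weyl_def norm_mult)
qed

text \<open>
  As a function of \<open>p\<close>, the matrix coefficient of \<open>f\<close> at \<open>(q, p)\<close> is, up to a phase, the Fourier
  transform of \<open>x \<mapsto> f x * cnj (f (x - q))\<close>; so the matrix coefficients determine
  \<open>f x * cnj (f y)\<close>, which is \<open>f\<close> up to a phase.
\<close>

lemma weyl_coefficients_determine:
  assumes f: "f \<in> L2" and g: "g \<in> L2"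
    and eq: "\<And>w. L2_inner f (weyl w f) = L2_inner g (weyl w g)"
  obtains c where "cmod c = 1" "AE x in lborel. f x = c * g x"
proof -
  have [measurable]: "f \<in> borel_measurable borel" "g \<in> borel_measurable borel"
    using f g by (simp_all add: L2_def)
  \<comment> \<open>The momentum is taken as \<open>- p\<close> so that conjugating the second
    argument produces frequency \<open>p\<close>. The phase in front comes from the symmetric choice
    of phase in \<open>weyl\<close>, and is the same for \<open>f\<close> and
    \<open>g\<close>.\<close>
  have coeff: "L2_inner h (weyl (vector [q, - p]) h)
      = cis (- p * q / 2) * (LINT x|lborel. iexp (p * x) * (h x * cnj (h (x - q))))" for h p q
  proof -
    have "h x * cnj (cis (- p * (x - q / 2)) * h (x - q))
        = cis (- p * q / 2) * (iexp (p * x) * (h x * cnj (h (x - q))))" for x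
    proof -
      have "cnj (cis (- p * (x - q / 2))) = cis (- p * q / 2) * cis (p * x)"
        by (simp add: cis_cnj cis_mult right_diff_distrib)
      then show ?thesis
        by (simp add: cis_conv_exp algebra_simps)
    qed
    then show ?thesis
      unfolding L2_inner_def weyl_def vector_2 by (simp only: integral_mult_right_zero)
  qed
  have AE_q: "AE x in lborel. f x * cnj (f (x - q)) = g x * cnj (g (x - q))" for q
  proof -
    have int: "integrable lborel (\<lambda>x. f x * cnj (f (x - q)))" "integrable lborel (\<lambda>x. g x * cnj (g (x - q)))"
      by (intro L2_times_cnj_integrable f g L2_translate)+
    have "AE x in lborel. f x * cnj (f (x - q)) - g x * cnj (g (x - q)) = 0"
    proof (rule Fourier_eq_0_imp_AE_eq_0)
      fix p
      have "(LINT x|lborel. iexp (p * x) * (f x * cnj (f (x - q)) - g x * cnj (g (x - q))))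
        = (LINT x|lborel. iexp (p * x) * (f x * cnj (f (x - q)))) - (LINT x|lborel. iexp (p * x) * (g x * cnj (g (x - q))))"
        unfolding right_diff_distrib by (intro Bochner_Integration.integral_diff integrable_iexp_times int)
      also have "\<dots> = 0"
        using eq [of "vector [q, - p]"] by (simp add: coeff)
      finally show "(LINT x|lborel. iexp (p * x) * (f x * cnj (f (x - q)) - g x * cnj (g (x - q)))) = 0" .
    qed (use int in simp)
    then show ?thesis by simp
  qed
  \<comment> \<open>The exceptional null set of \<open>x\<close> in \<open>AE_q\<close> depends on
    \<open>q\<close>. Since the relation is jointly measurable, Fubini exchanges the quantifiers:
    almost every \<open>x\<close> is good for almost every \<open>q\<close>.\<close>
  have "AE x in lborel. AE q in lborel. f x * cnj (f (x - q)) = g x * cnj (g (x - q))"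
  proof (subst lborel_pair.AE_commute)
    show "{x \<in> space (lborel \<Otimes>\<^sub>M lborel). f (fst x) * cnj (f (fst x - snd x)) = g (fst x) * cnj (g (fst x - snd x))}
        \<in> sets (lborel \<Otimes>\<^sub>M lborel)"
      by measurable
  qed (use AE_q in simp)
  moreover have "AE y in lborel. f x * cnj (f y) = g x * cnj (g y)"
    if "AE q in lborel. f x * cnj (f (x - q)) = g x * cnj (g (x - q))" for x
  proof -
    \<comment> \<open>For fixed \<open>x\<close> the reflection sending \<open>q\<close> to
      \<open>y = x - q\<close> preserves Lebesgue measure, so almost every \<open>q\<close> becomes
      almost every \<open>y\<close>.\<close>
    have "lborel = distr lborel borel (\<lambda>q. x - q)"
      using lborel_real_affine [of "-1" x] by (simp add: density_1)
    note distr = this [symmetric]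
    have "(AE y in distr lborel borel (\<lambda>q. x - q). f x * cnj (f y) = g x * cnj (g y))
       \<longleftrightarrow> (AE q in lborel. f x * cnj (f (x - q)) = g x * cnj (g (x - q)))"
      by (rule AE_distr_iff) auto
    then show ?thesis
      unfolding distr using that by simp
  qed
  ultimately have AE2: "AE x in lborel. AE y in lborel. f x * cnj (f y) = g x * cnj (g y)"
    by (rule eventually_mono)
  \<comment> \<open>The Weyl operator at 0 is the identity, so this coefficient is the squared
    norm.\<close>
  have "L2_inner f (weyl 0 f) = L2_inner g (weyl 0 g)"
    by (rule eq)
  then have norms: "(LINT x|lborel. (cmod (f x))\<^sup>2) = (LINT x|lborel. (cmod (g x))\<^sup>2)"
    by (simp add: weyl_def L2_inner_self)
  have intf: "integrable lborel (\<lambda>x. (cmod (f x))\<^sup>2)" and intg: "integrable lborel (\<lambda>x. (cmod (g x))\<^sup>2)"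
    using f g by (simp_all add: L2_def)
  show thesis
  proof (cases "AE x in lborel. g x = 0")
    case True
    then have "(LINT x|lborel. (cmod (g x))\<^sup>2) = 0"
      by (subst integral_nonneg_eq_0_iff_AE [OF intg]) auto
    then have "AE x in lborel. f x = 0"
      using norms integral_nonneg_eq_0_iff_AE [OF intf] by simp
    with True have "AE x in lborel. f x = 1 * g x"
      by eventually_elim simp
    then show ?thesis
      by (intro that [of 1]) auto
  next
    case False
    \<comment> \<open>Almost every \<open>x\<close> is good. If \<open>g\<close> vanished at all
      good points, it would vanish almost everywhere. Fixing one good point \<open>a\<close> with
      \<open>g a \<noteq> 0\<close> turns the relation for \<open>f x * cnj (f y)\<close> into
      proportionality in \<open>y\<close>.\<close>
    have "\<exists>x. g x \<noteq> 0 \<and> (AE y in lborel. f x * cnj (f y) = g x * cnj (g y))"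
    proof (rule ccontr)
      assume *: "\<not> ?thesis"
      from AE2 have "AE x in lborel. g x = 0"
        by eventually_elim (use * in blast)
      with False show False by simp
    qed
    then obtain a where a: "g a \<noteq> 0" and AEa: "AE y in lborel. f a * cnj (f y) = g a * cnj (g y)"
      by blast
    have fa: "f a \<noteq> 0"
    proof
      assume *: "f a = 0"
      from AEa have "AE y in lborel. g y = 0"
        by eventually_elim (use a * in simp)
      with False show False by simp
    qed
    \<comment> \<open>Divide the relation at \<open>a\<close> by \<open>f a\<close> and conjugate.
      Equality of the norms will then force modulus 1.\<close>
    define c where "c = cnj (g a / f a)"
    have AEc: "AE y in lborel. f y = c * g y"
      using AEa
    proof eventually_elim
      case (elim y)
      then have "cnj (f y) = g a / f a * cnj (g y)"
        using fa by (simp add: field_simps)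
      then have "cnj (cnj (f y)) = cnj (g a / f a * cnj (g y))"
        by simp
      then show ?case
        by (simp add: c_def)
    qed
    have "(LINT x|lborel. (cmod (f x))\<^sup>2) = (LINT x|lborel. (cmod c)\<^sup>2 * (cmod (g x))\<^sup>2)"
    proof (intro integral_cong_AE)
      show "AE x in lborel. (cmod (f x))\<^sup>2 = (cmod c)\<^sup>2 * (cmod (g x))\<^sup>2"
        using AEc by eventually_elim (simp add: norm_mult power_mult_distrib)
    qed simp_all
    then have "(LINT x|lborel. (cmod (g x))\<^sup>2) = (cmod c)\<^sup>2 * (LINT x|lborel. (cmod (g x))\<^sup>2)"
      using norms by simp
    moreover have "(LINT x|lborel. (cmod (g x))\<^sup>2) \<noteq> 0"
      using False by (subst integral_nonneg_eq_0_iff_AE [OF intg]) auto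
    ultimately have "(cmod c)\<^sup>2 = 1"
      by simp
    then have "cmod c = 1"
      using norm_ge_zero [of c] by (auto simp: power2_eq_1_iff)
    with AEc show ?thesis
      by (intro that)
  qed
qed

text \<open>Invertibility of \<open>S\<close> lets \<open>S *v w\<close> run through all of phase
  space, so \<open>U f\<close> and \<open>V f\<close> agree in every Weyl coefficient. The phase is
  obtained for one vector \<open>f\<close> at a time, which is enough for the Gaussian.\<close>

lemma metaplectic_unique:
  assumes U: "metaplectic S U" and V: "metaplectic S V" and S: "invertible S" and f: "f \<in> L2"
  obtains c where "cmod c = 1" "AE x in lborel. U f x = c * V f x"
proof -
  have L2: "W h \<in> L2" if "metaplectic S W" "h \<in> L2" for W h
    using that by (auto simp: metaplectic_def unitary_L2_def)
  have coeff: "L2_inner (W f) (weyl (S *v w) (W f)) = L2_inner f (weyl w f)"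
    if W: "metaplectic S W" for W w
  proof -
    have Wf: "W f \<in> L2"
      by (rule L2 [OF W f])
    have "L2_inner (W f) (weyl (S *v w) (W f)) = L2_inner (W f) (W (weyl w f))"
    proof (rule L2_inner_cong_AE [OF Wf Wf weyl_L2 [OF Wf] L2 [OF W weyl_L2 [OF f]]])
      have "AE x in lborel. W (weyl w f) x = weyl (S *v w) (W f) x"
        using W f by (simp add: metaplectic_def)
      then show "AE x in lborel. weyl (S *v w) (W f) x = W (weyl w f) x"
        by eventually_elim simp
    qed simp
    also have "\<dots> = L2_inner f (weyl w f)"
      using W f weyl_L2 [OF f] by (auto simp: metaplectic_def unitary_L2_def)
    finally show ?thesis .
  qed
  have "L2_inner (U f) (weyl v (U f)) = L2_inner (V f) (weyl v (V f))" for v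
  proof -
    obtain T where "S ** T = mat 1"
      using S by (auto simp: invertible_def)
    then have "S *v (T *v v) = v"
      by (simp add: matrix_vector_mul_assoc)
    then show ?thesis
      using coeff [OF U, of "T *v v"] coeff [OF V, of "T *v v"] by simp
  qed
  then show thesis
    by (rule weyl_coefficients_determine [OF L2 [OF U f] L2 [OF V f]]) (rule that)
qed

section \<open>Gaussian integrals\<close>

text \<open>No contour shift is made: the square is completed for \<open>Re B\<close> only. The
  substitution \<open>y = c * x - Re B / c\<close> gives a standard normal density, and
  \<open>Im B\<close> becomes a frequency \<open>t\<close> in its known characteristic
  function.\<close>

lemma has_bochner_integral_gaussian_complex:
  fixes A :: real and B :: complex
  assumes A: "A > 0"
  shows "has_bochner_integral lborel (\<lambda>x. exp (B * of_real x - of_real (A * x\<^sup>2)))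
    (of_real (sqrt (pi / A)) * exp (B\<^sup>2 / of_real (4 * A)))"
proof -
  define c where "c = sqrt (2 * A)"
  define t where "t = Im B / c"
  \<comment> \<open>\<open>X\<close> collects the constants in the exponent left over by the
    substitution, and \<open>k\<close> also removes the normalization of the density.\<close>
  define X where "X = of_real ((Re B / c)\<^sup>2 / 2) + \<i> * of_real (Re B * Im B / c\<^sup>2)"
  define k where "k = of_real (sqrt (2 * pi)) * exp X"
  have c: "c > 0" "c\<^sup>2 = 2 * A"
    using A by (simp_all add: c_def)
  have int: "integrable lborel (\<lambda>y. of_real (std_normal_density y) * iexp (t * y))"
    by (rule Bochner_Integration.integrable_bound [OF integrable_normal_density [of 1 0]])
       (simp_all add: norm_mult)
  have "(LINT y|lborel. of_real (std_normal_density y) * iexp (t * y)) = char std_normal_distribution t"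
    unfolding char_def by (subst integral_density) (auto simp: scaleR_conv_of_real)
  also have "\<dots> = of_real (exp (- t\<^sup>2 / 2))"
    by (simp add: char_std_normal_distribution)
  finally have "has_bochner_integral lborel (\<lambda>y. of_real (std_normal_density y) * iexp (t * y)) (of_real (exp (- t\<^sup>2 / 2)) :: complex)"
    using int by (simp add: has_bochner_integral_iff)
  then have "has_bochner_integral lborel
      (\<lambda>x. of_real (std_normal_density (- Re B / c + c * x)) * iexp (t * (- Re B / c + c * x)))
      (of_real (exp (- t\<^sup>2 / 2)) /\<^sub>R \<bar>c\<bar>)"
    using c by (subst (asm) lborel_has_bochner_integral_real_affine_iff [where c = c and t = "- Re B / c"]) auto
  then have "has_bochner_integral lborel
      (\<lambda>x. k * (of_real (std_normal_density (- Re B / c + c * x)) * iexp (t * (- Re B / c + c * x))))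
      (k * (of_real (exp (- t\<^sup>2 / 2)) /\<^sub>R \<bar>c\<bar>))"
    by (rule has_bochner_integral_mult_right)
  moreover have "k * (of_real (std_normal_density (- Re B / c + c * x)) * iexp (t * (- Re B / c + c * x)))
      = exp (B * of_real x - of_real (A * x\<^sup>2))" for x
  proof -
    have "k * (of_real (std_normal_density (- Re B / c + c * x)) * iexp (t * (- Re B / c + c * x)))
       = exp (X + of_real (- (- Re B / c + c * x)\<^sup>2 / 2) + \<i> * of_real (t * (- Re B / c + c * x)))"
      by (simp only: k_def std_normal_density_def exp_add exp_of_real of_real_mult) simp
    also have "X + of_real (- (- Re B / c + c * x)\<^sup>2 / 2) + \<i> * of_real (t * (- Re B / c + c * x))
         = of_real ((Re B / c)\<^sup>2 / 2 - (- Re B / c + c * x)\<^sup>2 / 2)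
           + \<i> * of_real (Re B * Im B / c\<^sup>2 + t * (- Re B / c + c * x))"
      by (simp add: X_def algebra_simps)
    also have "(Re B / c)\<^sup>2 / 2 - (- Re B / c + c * x)\<^sup>2 / 2 = Re B * x - A * x\<^sup>2"
      using c by (simp add: power2_diff power_mult_distrib algebra_simps) (simp add: field_simps power2_eq_square)
    also have "Re B * Im B / c\<^sup>2 + t * (- Re B / c + c * x) = Im B * x"
      using c(1) by (simp add: t_def field_simps power2_eq_square)
    also have "of_real (Re B * x - A * x\<^sup>2) + \<i> * of_real (Im B * x) = B * of_real x - of_real (A * x\<^sup>2)"
      by (simp add: complex_eq_iff)
    finally show ?thesis .
  qed
  moreover have "k * (of_real (exp (- t\<^sup>2 / 2)) /\<^sub>R \<bar>c\<bar>) = of_real (sqrt (pi / A)) * exp (B\<^sup>2 / of_real (4 * A))"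
  proof -
    have "k * (of_real (exp (- t\<^sup>2 / 2)) /\<^sub>R \<bar>c\<bar>)
      = of_real (sqrt (2 * pi) / c) * (exp X * of_real (exp (- t\<^sup>2 / 2)))"
      unfolding k_def scaleR_conv_of_real of_real_divide of_real_inverse divide_inverse abs_of_pos [OF c(1)] of_real_mult
      by (simp only: mult_ac)
    also have "exp X * of_real (exp (- t\<^sup>2 / 2)) = exp (X + of_real (- t\<^sup>2 / 2))"
      by (simp only: exp_add exp_of_real)
    also have "sqrt (2 * pi) / c = sqrt (pi / A)"
      by (simp add: c_def real_sqrt_mult real_sqrt_divide)
    \<comment> \<open>Since \<open>t\<^sup>2 / 2 = (Im B)\<^sup>2 / (4 * A)\<close>, the
      contributions of \<open>Re B\<close> and \<open>Im B\<close> reassemble into the square of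
      \<open>B\<close>.\<close>
    also have "X + of_real (- t\<^sup>2 / 2) = B\<^sup>2 / of_real (4 * A)"
    proof -
      have "Re (X + of_real (- t\<^sup>2 / 2)) = ((Re B)\<^sup>2 - (Im B)\<^sup>2) / (4 * A)"
        by (simp add: X_def t_def power_divide c(2) diff_divide_distrib)
      moreover have "Im (X + of_real (- t\<^sup>2 / 2)) = 2 * Re B * Im B / (4 * A)"
        by (simp add: X_def c(2))
      ultimately show ?thesis
        unfolding complex_eq_iff Re_divide_of_real Im_divide_of_real Re_power2 Im_power2 by blast
    qed
    finally show ?thesis .
  qed
  ultimately show ?thesis by simp
qed

lemma has_bochner_integral_gaussian:
  fixes A :: real
  assumes "A > 0"
  shows "has_bochner_integral lborel (\<lambda>x. exp (- A * x\<^sup>2)) (sqrt (pi / A))"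
proof -
  have "has_bochner_integral lborel (\<lambda>x. exp (of_real (- A * x\<^sup>2))) (complex_of_real (sqrt (pi / A)))"
    using has_bochner_integral_gaussian_complex [OF assms, of 0] by simp
  then have "has_bochner_integral lborel (\<lambda>x. complex_of_real (exp (- A * x\<^sup>2))) (complex_of_real (sqrt (pi / A)))"
    by (simp only: exp_of_real)
  then show ?thesis
    unfolding has_bochner_integral_iff complex_of_real_integrable_eq integral_complex_of_real of_real_eq_iff .
qed

section \<open>Integration over the complex plane as iterated integration\<close>

lemma borel_measurable_Complex:
  "(\<lambda>(x, y). Complex x y) \<in> borel_measurable (lborel \<Otimes>\<^sub>M lborel)"
proof -
  have "(\<lambda>p. of_real (fst p) + \<i> * of_real (snd p) :: complex) \<in> borel_measurable borel"
    by (intro borel_measurable_continuous_onI continuous_intros)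
  then show ?thesis
    unfolding lborel_prod by (simp add: Complex_eq case_prod_unfold)
qed

text \<open>Lebesgue measure is determined by its values on open boxes, and a complex box pulls back
  to a rectangle.\<close>

lemma lborel_complex_eq_distr:
  "(lborel :: complex measure) = distr (lborel \<Otimes>\<^sub>M lborel) borel (\<lambda>(x, y). Complex x y)"
proof (rule lborel_eqI)
  note borel_measurable_Complex [measurable]
  fix l u :: complex
  assume le: "\<And>b. b \<in> Basis \<Longrightarrow> l \<bullet> b \<le> u \<bullet> b"
  have *: "(\<lambda>(x, y). Complex x y) -` box l u \<inter> space (lborel \<Otimes>\<^sub>M lborel) = {Re l <..< Re u} \<times> {Im l <..< Im u}"
    by (auto simp: space_pair_measure in_box_complex_iff)
  have "emeasure (distr (lborel \<Otimes>\<^sub>M lborel) borel (\<lambda>(x, y). Complex x y)) (box l u)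
      = emeasure lborel {Re l <..< Re u} * emeasure lborel {Im l <..< Im u}"
    by (subst emeasure_distr) (simp_all add: * lborel.emeasure_pair_measure_Times)
  also have "\<dots> = (\<Prod>b\<in>Basis. (u - l) \<bullet> b)"
    using le [of 1] le [of \<i>] by (simp add: Basis_complex_def ennreal_mult complex_eq_iff)
  finally show "emeasure (distr (lborel \<Otimes>\<^sub>M lborel) borel (\<lambda>(x, y). Complex x y)) (box l u)
      = (\<Prod>b\<in>Basis. (u - l) \<bullet> b)" .
qed simp

text \<open>A majorant that factors is what Gaussian weights provide: integrability over the plane
  reduces to two integrals over the line, and Fubini applies.\<close>

lemma
  fixes f :: "complex \<Rightarrow> 'a :: {banach, second_countable_topology}"
  assumes [measurable]: "f \<in> borel_measurable borel"
    and u: "integrable lborel u" and v: "integrable lborel v"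
    and le: "\<And>x y. norm (f (Complex x y)) \<le> u x * v y"
  shows integrable_complex_dominated: "integrable lborel f"
    and integral_complex_iterated: "(LINT z|lborel. f z) = (LINT x|lborel. LINT y|lborel. f (Complex x y))"
proof -
  note C [measurable] = borel_measurable_Complex
  have fm [measurable]: "(\<lambda>(x, y). f (Complex x y)) \<in> borel_measurable (lborel \<Otimes>\<^sub>M lborel)"
    using measurable_compose [OF C assms(1)] by (simp add: split_beta)
  have int: "integrable (lborel \<Otimes>\<^sub>M lborel) (\<lambda>(x, y). f (Complex x y))"
  proof (rule Bochner_Integration.integrable_bound [OF _ fm])
    have [measurable]: "u \<in> borel_measurable borel" "v \<in> borel_measurable borel"
      using u v by (auto dest: borel_measurable_integrable)
    show "integrable (lborel \<Otimes>\<^sub>M lborel) (\<lambda>(x, y). u x * v y)"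
    proof (rule lborel_pair.Fubini_integrable)
      show "integrable lborel (\<lambda>x. LINT y|lborel. norm (case (x, y) of (x, y) \<Rightarrow> u x * v y))"
        using u by (simp add: abs_mult)
    qed (use v in auto)
  qed (auto intro!: always_eventually order_trans [OF le])
  show "integrable lborel f"
    unfolding lborel_complex_eq_distr
    by (subst integrable_distr_eq) (use int in \<open>auto simp: case_prod_unfold\<close>)
  have "(LINT z|lborel. f z) = integral\<^sup>L (lborel \<Otimes>\<^sub>M lborel) (\<lambda>p. f (case p of (x, y) \<Rightarrow> Complex x y))"
    unfolding lborel_complex_eq_distr by (rule integral_distr) auto
  also have "\<dots> = (LINT x|lborel. LINT y|lborel. f (Complex x y))"
    using lborel_pair.integral_fst' [OF int] by (simp add: case_prod_unfold)
  finally show "(LINT z|lborel. f z) = (LINT x|lborel. LINT y|lborel. f (Complex x y))" .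
qed

section \<open>Integrals of squeezed exponentials against the Fock weight\<close>

text \<open>The real part of the square of \<open>Complex x y\<close> is
  \<open>x\<^sup>2 - y\<^sup>2\<close>, so the weighted modulus separates.\<close>

lemma cmod_exp_square_times_gaussian:
  "cmod (exp (of_real (b / 2) * (Complex x y)\<^sup>2)) * exp (- (cmod (Complex x y))\<^sup>2)
    = exp (- (1 - b / 2) * x\<^sup>2) * exp (- (1 + b / 2) * y\<^sup>2)"
proof -
  have "Re (of_real (b / 2) * (Complex x y)\<^sup>2) = b / 2 * (x\<^sup>2 - y\<^sup>2)"
    by (simp add: power2_eq_square)
  then show ?thesis
    by (simp add: cmod_power2 algebra_simps flip: exp_add)
qed

text \<open>Squaring the modulus doubles \<open>b\<close>, so the separated Gaussians have rates
  \<open>1 - b\<close> and \<open>1 + b\<close>, both positive for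
  \<open>\<bar>b\<bar> < 1\<close>.\<close>

lemma
  fixes b :: real
  assumes b: "\<bar>b\<bar> < 1"
  shows integrable_Fock_squeezed:
      "integrable lborel (\<lambda>z. (cmod (exp (of_real (b / 2) * z\<^sup>2)))\<^sup>2 * exp (- (cmod z)\<^sup>2))"
    and integral_Fock_squeezed:
      "(LINT z|lborel. (cmod (exp (of_real (b / 2) * z\<^sup>2)))\<^sup>2 * exp (- (cmod z)\<^sup>2)) = pi / sqrt (1 - b\<^sup>2)"
proof -
  have eq: "(cmod (exp (of_real (b / 2) * (Complex x y)\<^sup>2)))\<^sup>2 * exp (- (cmod (Complex x y))\<^sup>2)
      = exp (- (1 - b) * x\<^sup>2) * exp (- (1 + b) * y\<^sup>2)" for x y
  proof -
    have "(cmod (exp (of_real (b / 2) * (Complex x y)\<^sup>2)))\<^sup>2 = cmod (exp (of_real (2 * b / 2) * (Complex x y)\<^sup>2))"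
      by (simp add: power2_eq_square flip: norm_mult exp_add distrib_right)
    then show ?thesis
      using cmod_exp_square_times_gaussian [of "2 * b" x y] by simp
  qed
  have x: "has_bochner_integral lborel (\<lambda>x. exp (- (1 - b) * x\<^sup>2)) (sqrt (pi / (1 - b)))"
    and y: "has_bochner_integral lborel (\<lambda>x. exp (- (1 + b) * x\<^sup>2)) (sqrt (pi / (1 + b)))"
    by (rule has_bochner_integral_gaussian; use b in linarith)+
  have fm: "(\<lambda>z. (cmod (exp (of_real (b / 2) * z\<^sup>2)))\<^sup>2 * exp (- (cmod z)\<^sup>2)) \<in> borel_measurable borel"
    by (intro borel_measurable_continuous_onI continuous_intros)
  have le: "norm ((cmod (exp (of_real (b / 2) * (Complex x y)\<^sup>2)))\<^sup>2 * exp (- (cmod (Complex x y))\<^sup>2))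
     \<le> exp (- (1 - b) * x\<^sup>2) * exp (- (1 + b) * y\<^sup>2)" for x y
    by (subst eq) simp
  have xi: "integrable lborel (\<lambda>x. exp (- (1 - b) * x\<^sup>2))" and yi: "integrable lborel (\<lambda>x. exp (- (1 + b) * x\<^sup>2))"
    using x y by (simp_all add: has_bochner_integral_iff)
  show "integrable lborel (\<lambda>z. (cmod (exp (of_real (b / 2) * z\<^sup>2)))\<^sup>2 * exp (- (cmod z)\<^sup>2))"
    by (rule integrable_complex_dominated [OF fm xi yi le])
  have "(LINT z|lborel. (cmod (exp (of_real (b / 2) * z\<^sup>2)))\<^sup>2 * exp (- (cmod z)\<^sup>2))
     = (LINT x|lborel. LINT y|lborel. exp (- (1 - b) * x\<^sup>2) * exp (- (1 + b) * y\<^sup>2))"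
    by (subst integral_complex_iterated [OF fm xi yi le]) (simp only: eq)
  also have "\<dots> = sqrt (pi / (1 - b)) * sqrt (pi / (1 + b))"
    by (simp only: integral_mult_right_zero integral_mult_left_zero
          has_bochner_integral_integral_eq [OF x] has_bochner_integral_integral_eq [OF y])
  also have "\<dots> = sqrt (pi\<^sup>2 / (1 - b\<^sup>2))"
    by (simp add: power2_eq_square algebra_simps flip: real_sqrt_mult)
  also have "\<dots> = pi / sqrt (1 - b\<^sup>2)"
    by (simp add: real_sqrt_divide)
  finally show "(LINT z|lborel. (cmod (exp (of_real (b / 2) * z\<^sup>2)))\<^sup>2 * exp (- (cmod z)\<^sup>2)) = pi / sqrt (1 - b\<^sup>2)" .
qed

text \<open>The value agrees with the mean value property, as the exponential equals 1 at the
  origin; here it is found by iterated integration. In \<open>y\<close> the cross term of the square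
  gives a linear term with imaginary coefficient \<open>b * x\<close>, whence the complex Gaussian
  integral.\<close>

lemma integral_Fock_squeezed_vacuum:
  fixes b :: real
  assumes b: "\<bar>b\<bar> < 2"
  shows "(LINT z|lborel. exp (of_real (b / 2) * z\<^sup>2) * of_real (exp (- (cmod z)\<^sup>2))) = of_real pi"
proof -
  define \<beta> where "\<beta> = 1 + b / 2"
  have \<beta>: "\<beta> > 0" "b = 2 * \<beta> - 2"
    using b by (auto simp: \<beta>_def)
  have xi: "integrable lborel (\<lambda>x. exp (- (1 - b / 2) * x\<^sup>2))" and yi: "integrable lborel (\<lambda>x. exp (- (1 + b / 2) * x\<^sup>2))"
    using b has_bochner_integral_gaussian [of "1 - b / 2"] has_bochner_integral_gaussian [of "1 + b / 2"]
    unfolding has_bochner_integral_iff by linarith+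
  have fm: "(\<lambda>z. exp (of_real (b / 2) * z\<^sup>2) * of_real (exp (- (cmod z)\<^sup>2))) \<in> borel_measurable borel"
    by (intro borel_measurable_continuous_onI continuous_intros)
  have le: "norm (exp (of_real (b / 2) * (Complex x y)\<^sup>2) * complex_of_real (exp (- (cmod (Complex x y))\<^sup>2)))
     \<le> exp (- (1 - b / 2) * x\<^sup>2) * exp (- (1 + b / 2) * y\<^sup>2)" for x y
    using cmod_exp_square_times_gaussian [of b x y] by (simp add: norm_mult)
  have inner: "(LINT y|lborel. exp (of_real (b / 2) * (Complex x y)\<^sup>2) * of_real (exp (- (cmod (Complex x y))\<^sup>2)))
      = of_real (sqrt (pi / \<beta>) * exp (- (1 / \<beta>) * x\<^sup>2))" for x
  proof -
    have "exp (of_real (b / 2) * (Complex x y)\<^sup>2) * of_real (exp (- (cmod (Complex x y))\<^sup>2))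
        = of_real (exp ((b / 2 - 1) * x\<^sup>2)) * exp (\<i> * of_real (b * x) * of_real y - of_real (\<beta> * y\<^sup>2))" for y
      unfolding exp_of_real [symmetric] exp_add [symmetric]
      by (rule arg_cong [of _ _ exp])
         (simp add: complex_eq_iff cmod_power2 Re_power2 Im_power2 \<beta>_def field_simps)
    then have "(LINT y|lborel. exp (of_real (b / 2) * (Complex x y)\<^sup>2) * of_real (exp (- (cmod (Complex x y))\<^sup>2)))
        = of_real (exp ((b / 2 - 1) * x\<^sup>2)) * (LINT y|lborel. exp (\<i> * of_real (b * x) * of_real y - of_real (\<beta> * y\<^sup>2)))"
      by (simp only: integral_mult_right_zero)
    also have "\<dots> = of_real (exp ((b / 2 - 1) * x\<^sup>2)) * (of_real (sqrt (pi / \<beta>)) * exp ((\<i> * of_real (b * x))\<^sup>2 / of_real (4 * \<beta>)))"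
      by (simp only: has_bochner_integral_integral_eq [OF has_bochner_integral_gaussian_complex [OF \<beta>(1)]])
    also have "(\<i> * of_real (b * x))\<^sup>2 / of_real (4 * \<beta>) = (of_real (- (b * x)\<^sup>2 / (4 * \<beta>)) :: complex)"
      by (simp add: power_mult_distrib)
    also have "of_real (exp ((b / 2 - 1) * x\<^sup>2)) * (of_real (sqrt (pi / \<beta>)) * exp (of_real (- (b * x)\<^sup>2 / (4 * \<beta>)) :: complex))
        = of_real (sqrt (pi / \<beta>) * exp ((b / 2 - 1) * x\<^sup>2 + - (b * x)\<^sup>2 / (4 * \<beta>)))"
      by (simp only: exp_of_real exp_add of_real_mult mult_ac)
    \<comment> \<open>With \<open>b = 2 * \<beta> - 2\<close> the coefficient is
      \<open>\<beta> - 2 - (\<beta> - 1)\<^sup>2 / \<beta>\<close>, that is,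
      \<open>- 1 / \<beta>\<close>.\<close>
    also have "(b / 2 - 1) * x\<^sup>2 + - (b * x)\<^sup>2 / (4 * \<beta>) = - (1 / \<beta>) * x\<^sup>2"
      unfolding \<beta>(2) using \<beta>(1) by (simp add: field_simps power2_eq_square)
    finally show ?thesis .
  qed
  have "(LINT z|lborel. exp (of_real (b / 2) * z\<^sup>2) * of_real (exp (- (cmod z)\<^sup>2)))
      = of_real (LINT x|lborel. sqrt (pi / \<beta>) * exp (- (1 / \<beta>) * x\<^sup>2))"
    by (subst integral_complex_iterated [OF fm xi yi le]) (simp only: inner integral_complex_of_real)
  also have "(LINT x|lborel. sqrt (pi / \<beta>) * exp (- (1 / \<beta>) * x\<^sup>2)) = sqrt (pi / \<beta>) * sqrt (pi / (1 / \<beta>))"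
    using \<beta>(1) has_bochner_integral_integral_eq [OF has_bochner_integral_gaussian [of "1 / \<beta>"]]
    by (simp only: integral_mult_right_zero) simp
  also have "\<dots> = pi"
    using \<beta>(1) by (simp flip: real_sqrt_mult)
  finally show ?thesis .
qed

section \<open>The squeezed Gaussian and its Bargmann transform\<close>

lemma gauss_L2: "gauss \<in> L2"
proof -
  have "integrable lborel (\<lambda>x. (pi powr (-1/4))\<^sup>2 * exp (- 1 * x\<^sup>2))"
    using has_bochner_integral_gaussian [of 1] by (simp add: has_bochner_integral_iff)
  moreover have "(exp (- x\<^sup>2 / 2))\<^sup>2 = exp (- x\<^sup>2)" for x :: real
    by (simp add: power2_eq_square flip: exp_add)
  moreover have "gauss \<in> borel_measurable borel"
    unfolding gauss_def by measurable
  ultimately show ?thesis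
    by (simp add: L2_def gauss_def norm_mult power_mult_distrib)
qed

lemma pi_powr_quarter_square: "pi powr (-1/4) * pi powr (-1/4) = 1 / sqrt pi"
proof -
  have "pi powr (-1/4) * pi powr (-1/4) = pi powr - (1/2)"
    unfolding powr_add [symmetric] by simp
  then show ?thesis
    by (simp add: powr_minus_divide powr_half_sqrt)
qed

text \<open>The same constant occurs in the overlap and in the Bargmann transform. It equals the
  square root of \<open>2 * a / (a\<^sup>2 + 1)\<close>, and the identity \<open>(2 * a)\<^sup>2 =
  (a\<^sup>2 + 1)\<^sup>2 - (a\<^sup>2 - 1)\<^sup>2\<close> brings it into the form of the squeezing
  parameter.\<close>

lemma squeezed_normalization:
  fixes a :: real
  assumes a: "a > 0"
  shows "1 / sqrt pi * a powr (-1/2) * sqrt (pi / ((1 + 1 / a\<^sup>2) / 2))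
    = (1 - ((a\<^sup>2 - 1) / (a\<^sup>2 + 1))\<^sup>2) powr (1/4)"
proof -
  have pos: "a\<^sup>2 + 1 > 0"
    by (simp add: add_nonneg_pos)
  have "a powr (-1/2) = 1 / sqrt a"
    using a by (simp add: powr_minus_divide powr_half_sqrt)
  then have "1 / sqrt pi * a powr (-1/2) * sqrt (pi / ((1 + 1 / a\<^sup>2) / 2))
      = sqrt (1 / pi * (1 / a) * (pi / ((1 + 1 / a\<^sup>2) / 2)))"
    by (simp add: real_sqrt_mult real_sqrt_divide)
  also have "1 / pi * (1 / a) * (pi / ((1 + 1 / a\<^sup>2) / 2)) = 2 * a / (a\<^sup>2 + 1)"
    using a pos by (simp add: field_simps power2_eq_square)
  also have "sqrt (2 * a / (a\<^sup>2 + 1)) = ((2 * a / (a\<^sup>2 + 1)) powr 2) powr (1/4)"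
    unfolding powr_powr using a pos by (simp add: powr_half_sqrt)
  also have "(2 * a / (a\<^sup>2 + 1)) powr 2 = 1 - ((a\<^sup>2 - 1) / (a\<^sup>2 + 1))\<^sup>2"
  proof -
    have "(2 * a)\<^sup>2 = (a\<^sup>2 + 1)\<^sup>2 - (a\<^sup>2 - 1)\<^sup>2"
      by (simp add: power2_eq_square algebra_simps)
    then have "(2 * a / (a\<^sup>2 + 1))\<^sup>2 = 1 - ((a\<^sup>2 - 1) / (a\<^sup>2 + 1))\<^sup>2"
      using pos unfolding power_divide by (simp add: diff_divide_distrib)
    then show ?thesis
      using a pos by simp
  qed
  finally show ?thesis .
qed

lemma L2_inner_gauss_dilated:
  assumes a: "a > 0"
  shows "L2_inner gauss (\<lambda>x. of_real (a powr (-1/2)) * gauss (x / a))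
    = of_real ((1 - ((a\<^sup>2 - 1) / (a\<^sup>2 + 1))\<^sup>2) powr (1/4))"
proof -
  define A where "A = (1 + 1 / a\<^sup>2) / 2"
  have A: "A > 0"
    using a by (simp add: A_def add_pos_nonneg)
  have "gauss x * cnj (of_real (a powr (-1/2)) * gauss (x / a))
      = of_real (1 / sqrt pi * a powr (-1/2) * exp (- A * x\<^sup>2))" for x
  proof -
    have "exp (- x\<^sup>2 / 2) * exp (- (x / a)\<^sup>2 / 2) = exp (- A * x\<^sup>2)"
      using a by (simp add: A_def power_divide field_simps flip: exp_add)
    then have "1 / sqrt pi * a powr (-1/2) * exp (- A * x\<^sup>2)
        = (pi powr (-1/4) * exp (- x\<^sup>2 / 2)) * (a powr (-1/2) * (pi powr (-1/4) * exp (- (x / a)\<^sup>2 / 2)))"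
      unfolding pi_powr_quarter_square [symmetric] by (simp add: mult_ac)
    then show ?thesis
      by (simp only: gauss_def complex_cnj_mult complex_cnj_complex_of_real of_real_mult)
  qed
  then have "L2_inner gauss (\<lambda>x. of_real (a powr (-1/2)) * gauss (x / a))
      = of_real (1 / sqrt pi * a powr (-1/2) * (LINT x|lborel. exp (- A * x\<^sup>2)))"
    by (simp only: L2_inner_def integral_complex_of_real integral_mult_right_zero)
  also have "(LINT x|lborel. exp (- A * x\<^sup>2)) = sqrt (pi / A)"
    by (rule has_bochner_integral_integral_eq [OF has_bochner_integral_gaussian [OF A]])
  finally show ?thesis
    unfolding A_def squeezed_normalization [OF a] .
qed

text \<open>Kernel and Gaussian combine to rate \<open>A\<close> with complex linear coefficient
  \<open>sqrt 2 * z\<close>. The integral contributes \<open>z\<^sup>2 / (2 * A)\<close> to the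
  exponent, and \<open>1 / (2 * A) - 1 / 2 = b / 2\<close>.\<close>

lemma bargmann_gauss_dilated:
  assumes a: "a > 0"
  defines "b \<equiv> (a\<^sup>2 - 1) / (a\<^sup>2 + 1)"
  shows "bargmann (\<lambda>x. of_real (a powr (-1/2)) * gauss (x / a)) z
    = of_real ((1 - b\<^sup>2) powr (1/4)) * exp (of_real (b / 2) * z\<^sup>2)"
proof -
  define A where "A = (1 + 1 / a\<^sup>2) / 2"
  have A: "A > 0"
    using a by (simp add: A_def add_pos_nonneg)
  have pos: "a\<^sup>2 + 1 > 0"
    by (simp add: add_nonneg_pos)
  have "exp (- z\<^sup>2 / 2 + of_real (sqrt 2 * x) * z - of_real (x\<^sup>2 / 2)) * (of_real (a powr (-1/2)) * gauss (x / a))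
      = of_real (pi powr (-1/4) * a powr (-1/2)) * exp (- z\<^sup>2 / 2) * exp (of_real (sqrt 2) * z * of_real x - of_real (A * x\<^sup>2))" for x
  proof -
    have "exp (- z\<^sup>2 / 2 + of_real (sqrt 2 * x) * z - of_real (x\<^sup>2 / 2)) * exp (of_real (- (x / a)\<^sup>2 / 2))
      = exp (- z\<^sup>2 / 2) * exp (of_real (sqrt 2) * z * of_real x - of_real (A * x\<^sup>2))"
    proof -
      \<comment> \<open>Written so that the first term cancels the quadratic term of the Bargmann
        kernel.\<close>
      have *: "complex_of_real (- (x / a)\<^sup>2 / 2) = of_real (x\<^sup>2 / 2) - of_real (A * x\<^sup>2)"
        using a unfolding of_real_diff [symmetric] of_real_eq_iff by (simp add: A_def power_divide field_simps)
      show ?thesis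
        unfolding * exp_add [symmetric] by (simp add: algebra_simps)
    qed
    then show ?thesis
      by (simp only: gauss_def of_real_mult exp_of_real [symmetric] mult_ac)
  qed
  then have "bargmann (\<lambda>x. of_real (a powr (-1/2)) * gauss (x / a)) z
      = of_real (pi powr (-1/4)) * (of_real (pi powr (-1/4) * a powr (-1/2)) * exp (- z\<^sup>2 / 2)
          * (of_real (sqrt (pi / A)) * exp ((of_real (sqrt 2) * z)\<^sup>2 / of_real (4 * A))))"
    by (simp only: bargmann_def integral_mult_right_zero
         has_bochner_integral_integral_eq [OF has_bochner_integral_gaussian_complex [OF A]])
  also have "\<dots> = of_real (pi powr (-1/4) * pi powr (-1/4) * a powr (-1/2) * sqrt (pi / A))
      * exp (- z\<^sup>2 / 2 + (of_real (sqrt 2) * z)\<^sup>2 / of_real (4 * A))"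
    by (simp only: exp_add of_real_mult mult_ac)
  also have "pi powr (-1/4) * pi powr (-1/4) * a powr (-1/2) * sqrt (pi / A) = (1 - b\<^sup>2) powr (1/4)"
    unfolding pi_powr_quarter_square A_def squeezed_normalization [OF a] b_def ..
  also have "- z\<^sup>2 / 2 + (of_real (sqrt 2) * z)\<^sup>2 / of_real (4 * A) = of_real (b / 2) * z\<^sup>2"
  proof -
    have "b / 2 = - 1 / 2 + 2 / (4 * A)"
      using a pos by (simp add: b_def A_def field_simps)
    then have b2: "complex_of_real (b / 2) = - 1 / 2 + 2 / of_real (4 * A)"
      by simp
    have sqrt2: "(complex_of_real (sqrt 2))\<^sup>2 = 2"
      by (simp flip: of_real_power)
    show ?thesis
      unfolding b2 power_mult_distrib sqrt2 by (simp add: left_diff_distrib)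
  qed
  finally show ?thesis .
qed

section \<open>Transfer to an arbitrary metaplectic operator, and the parameters of
  \<open>S_mat\<close>\<close>

text \<open>By uniqueness \<open>U gauss\<close> is almost everywhere \<open>c\<close> times the
  dilated Gaussian, and both quantities are integrals. The phase enters the inner product
  conjugated, \<open>U gauss\<close> being its second argument.\<close>

lemma metaplectic_diag2_gauss:
  assumes a: "a > 0" and U: "metaplectic (diag2 a (inverse a)) U"
  defines "b \<equiv> (a\<^sup>2 - 1) / (a\<^sup>2 + 1)"
  obtains c where "cmod c = 1"
    "\<And>z. bargmann (U gauss) z = c * (of_real ((1 - b\<^sup>2) powr (1/4)) * exp (of_real (b / 2) * z\<^sup>2))"
    "L2_inner gauss (U gauss) = cnj c * of_real ((1 - b\<^sup>2) powr (1/4))"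
proof -
  define g where "g = (\<lambda>x. of_real (a powr (-1/2)) * gauss (x / a))"
  have V: "metaplectic (diag2 a (inverse a)) (\<lambda>f x. 1 * of_real (a powr (-1/2)) * f (x / a))"
    by (rule metaplectic_dilation [OF a]) simp
  have "diag2 a (inverse a) ** diag2 (inverse a) a = mat 1" "diag2 (inverse a) a ** diag2 a (inverse a) = mat 1"
    using a by (simp_all add: diag2_def matrix_matrix_mult_def mat_def vec_eq_iff forall_2 sum_2 vector_2)
  then have inv: "invertible (diag2 a (inverse a))"
    by (auto simp: invertible_def)
  obtain c where c: "cmod c = 1" and "AE x in lborel. U gauss x = c * (1 * of_real (a powr (-1/2)) * gauss (x / a))"
    by (rule metaplectic_unique [OF U V inv gauss_L2])
  then have AE: "AE x in lborel. U gauss x = c * g x"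
    by (simp add: g_def)
  have UL: "U gauss \<in> L2"
    using U gauss_L2 by (auto simp: metaplectic_def unitary_L2_def)
  have gL: "g \<in> L2"
    unfolding g_def by (rule L2_dilation [OF a gauss_L2])
  have [measurable]: "U gauss \<in> borel_measurable borel" "g \<in> borel_measurable borel" "gauss \<in> borel_measurable borel"
    using UL gL gauss_L2 by (auto simp: L2_def)
  have "bargmann (U gauss) z = c * (of_real ((1 - b\<^sup>2) powr (1/4)) * exp (of_real (b / 2) * z\<^sup>2))" for z
  proof -
    define K where "K = (\<lambda>x. exp (- z\<^sup>2 / 2 + of_real (sqrt 2 * x) * z - of_real (x\<^sup>2 / 2)))"
    have [measurable]: "K \<in> borel_measurable borel"
      unfolding K_def by (auto intro!: borel_measurable_continuous_onI continuous_intros)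
    have "(LINT x|lborel. K x * U gauss x) = (LINT x|lborel. c * (K x * g x))"
    proof (rule integral_cong_AE)
      show "AE x in lborel. K x * U gauss x = c * (K x * g x)"
        using AE by eventually_elim simp
    qed auto
    then have "bargmann (U gauss) z = c * bargmann g z"
      by (simp add: bargmann_def K_def)
    then show ?thesis
      by (simp only: g_def bargmann_gauss_dilated [OF a] b_def)
  qed
  moreover have "L2_inner gauss (U gauss) = cnj c * of_real ((1 - b\<^sup>2) powr (1/4))"
  proof -
    have "L2_inner gauss (U gauss) = (LINT x|lborel. cnj c * (gauss x * cnj (g x)))"
      unfolding L2_inner_def
    proof (rule integral_cong_AE)
      show "AE x in lborel. gauss x * cnj (U gauss x) = cnj c * (gauss x * cnj (g x))"
        using AE by eventually_elim simp
    qed auto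
    also have "\<dots> = cnj c * L2_inner gauss g"
      by (simp add: L2_inner_def)
    finally show ?thesis
      by (simp only: g_def L2_inner_gauss_dilated [OF a] b_def)
  qed
  ultimately show thesis
    using c that by blast
qed

lemma b_par_eq_exp:
  assumes "\<tau> > 0"
  shows "b_par \<tau> = exp (- 2 * \<tau>)"
proof -
  have s: "sinh \<tau> > 0"
    using assms by simp
  have "coth \<tau> - 1 = (cosh \<tau> - sinh \<tau>) / sinh \<tau>" "coth \<tau> + 1 = (cosh \<tau> + sinh \<tau>) / sinh \<tau>"
    using s by (simp_all add: coth_def diff_divide_distrib add_divide_distrib)
  then have "b_par \<tau> = (cosh \<tau> - sinh \<tau>) / (cosh \<tau> + sinh \<tau>)"
    using s by (simp add: b_par_def)
  also have "\<dots> = exp (- \<tau>) / exp \<tau>"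
    by (simp add: cosh_minus_sinh cosh_plus_sinh)
  also have "\<dots> = exp (- 2 * \<tau>)"
    by (simp flip: exp_diff)
  finally show ?thesis .
qed

text \<open>Brings \<open>S_mat\<close> into the form for which the dilations are metaplectic
  operators.\<close>

lemma S_mat_eq: "S_mat \<tau> = diag2 (sqrt (coth \<tau>)) (inverse (sqrt (coth \<tau>)))"
  by (simp add: S_mat_def coth_def tanh_def real_sqrt_divide)

theorem proposition12p5:
  fixes \<tau> :: real and U :: "(real \<Rightarrow> complex) \<Rightarrow> (real \<Rightarrow> complex)"
  assumes "\<tau> > 0"
    and "metaplectic (S_mat \<tau>) U"
  shows "S_mat \<tau> \<in> Sp2
    \<and> C_BF U = (1 - exp (- 4 * \<tau>)) powr (1/4)
    \<and> (1 - exp (- 4 * \<tau>)) powr (1/4) = (2 * sinh (2 * \<tau>)) powr (1/4) * exp (- \<tau> / 2)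
    \<and> b_par \<tau> = exp (- 2 * \<tau>)
    \<and> psi \<tau> \<in> Fock
    \<and> Fock_norm (psi \<tau>) = 1
    \<and> (\<exists>c. cmod c = 1 \<and> (\<forall>z. bargmann (U gauss) z = c * psi \<tau> z))
    \<and> cmod (Fock_inner (\<lambda>_. 1) (psi \<tau>)) = C_BF U"
proof -
  define a where "a = sqrt (coth \<tau>)"
  define b where "b = b_par \<tau>"
  \<comment> \<open>The value shared by the overlap, the prefactor of \<open>psi\<close> and its
    coefficient against the constant 1.\<close>
  define K where "K = (1 - b\<^sup>2) powr (1/4)"
  have coth: "coth \<tau> > 0"
    using assms(1) by (simp add: coth_def cosh_real_pos)
  then have a: "a > 0" "a\<^sup>2 = coth \<tau>"
    by (simp_all add: a_def)
  have b: "b = exp (- 2 * \<tau>)" "b = (a\<^sup>2 - 1) / (a\<^sup>2 + 1)"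
    using b_par_eq_exp [OF assms(1)] by (simp_all add: b_def b_par_def a)
  have b1: "0 < b" "b < 1"
    using assms(1) by (simp_all add: b(1))
  have b2: "b\<^sup>2 = exp (- 4 * \<tau>)"
    by (simp add: b(1) power2_eq_square flip: exp_add)
  have b2_less: "b\<^sup>2 < 1"
    using assms(1) by (simp add: b2)
  have psi: "psi \<tau> = (\<lambda>z. of_real K * exp (of_real (b / 2) * z\<^sup>2))"
    by (simp add: psi_def fun_eq_iff K_def b_def)
  have K: "K \<ge> 0" "K = (1 - exp (- 4 * \<tau>)) powr (1/4)"
    by (simp_all add: K_def b2)
  \<comment> \<open>Exactly what cancels the factor \<open>1 / sqrt (1 - b\<^sup>2)\<close> in the
    squared Fock norm.\<close>
  have K2: "K\<^sup>2 = sqrt (1 - b\<^sup>2)"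
    using b2_less by (simp add: K_def power2_eq_square powr_half_sqrt flip: powr_add)
  have S: "S_mat \<tau> = diag2 a (inverse a)"
    unfolding a_def by (rule S_mat_eq)
  have Sp2: "S_mat \<tau> \<in> Sp2"
    using a(1) unfolding S Sp2_def Let_def
    by (simp add: diag2_def transpose_def matrix_matrix_mult_def vec_eq_iff forall_2 sum_2 vector_2)
  obtain c where c: "cmod c = 1"
    and bargmann': "\<And>z. bargmann (U gauss) z = c * (of_real K * exp (of_real (b / 2) * z\<^sup>2))"
    and inner: "L2_inner gauss (U gauss) = cnj c * of_real K"
    by (rule metaplectic_diag2_gauss [OF a(1) assms(2) [unfolded S], folded b(2), folded K_def]) (rule that)
  have bargmann: "\<forall>z. bargmann (U gauss) z = c * psi \<tau> z"
    by (simp add: bargmann' psi)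
  have C: "C_BF U = K"
    using K(1) c by (simp add: C_BF_def inner norm_mult)
  have K_sinh: "K = (2 * sinh (2 * \<tau>)) powr (1/4) * exp (- \<tau> / 2)"
  proof -
    \<comment> \<open>The extracted factor \<open>exp (- 2 * \<tau>)\<close> has fourth root
      \<open>exp (- \<tau> / 2)\<close>.\<close>
    have "1 - exp (- 4 * \<tau>) = 2 * sinh (2 * \<tau>) * exp (- 2 * \<tau>)"
    proof -
      have "2 * sinh (2 * \<tau>) = exp (2 * \<tau>) - exp (- 2 * \<tau>)"
        by (simp add: sinh_field_def)
      then show ?thesis
        by (simp add: left_diff_distrib flip: exp_add)
    qed
    then have "K = (2 * sinh (2 * \<tau>)) powr (1/4) * exp (- 2 * \<tau>) powr (1/4)"
      using assms(1) by (simp add: K(2) powr_mult)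
    then show ?thesis
      by (simp add: powr_def)
  qed
  have sq: "(cmod (psi \<tau> z))\<^sup>2 * exp (- (cmod z)\<^sup>2)
      = K\<^sup>2 * ((cmod (exp (of_real (b / 2) * z\<^sup>2)))\<^sup>2 * exp (- (cmod z)\<^sup>2))" for z
    by (simp add: psi norm_mult power_mult_distrib)
  have Fock: "psi \<tau> \<in> Fock"
  proof -
    have "psi \<tau> holomorphic_on UNIV"
      unfolding psi by (intro holomorphic_intros)
    moreover have "integrable lborel (\<lambda>z. (cmod (psi \<tau> z))\<^sup>2 * exp (- (cmod z)\<^sup>2))"
      unfolding sq by (intro integrable_mult_right integrable_Fock_squeezed) (use b1 in simp)
    ultimately show ?thesis
      by (simp add: Fock_def)
  qed
  have norm: "Fock_norm (psi \<tau>) = 1"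
  proof -
    have "(LINT z|lborel. (cmod (psi \<tau> z))\<^sup>2 * exp (- (cmod z)\<^sup>2)) = K\<^sup>2 * (pi / sqrt (1 - b\<^sup>2))"
      unfolding sq by (subst integral_mult_right_zero, subst integral_Fock_squeezed) (use b1 in auto)
    also have "\<dots> = pi"
      using b2_less by (simp add: K2)
    finally show ?thesis
      by (simp add: Fock_norm_def)
  qed
  have vacuum: "cmod (Fock_inner (\<lambda>_. 1) (psi \<tau>)) = K"
  proof -
    \<comment> \<open>\<open>K\<close> and the weight are real, so the conjugation can be moved
      outside the integral.\<close>
    have "1 * cnj (psi \<tau> z) * of_real (exp (- (cmod z)\<^sup>2))
        = cnj (of_real K * (exp (of_real (b / 2) * z\<^sup>2) * of_real (exp (- (cmod z)\<^sup>2))))" for z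
      by (simp add: psi)
    then have "(LINT z|lborel. 1 * cnj (psi \<tau> z) * of_real (exp (- (cmod z)\<^sup>2)))
        = cnj (of_real K * (LINT z|lborel. exp (of_real (b / 2) * z\<^sup>2) * of_real (exp (- (cmod z)\<^sup>2))))"
      by (simp only: Bochner_Integration.integral_cnj integral_mult_right_zero)
    also have "\<dots> = of_real (K * pi)"
      by (subst integral_Fock_squeezed_vacuum) (use b1 in auto)
    finally show ?thesis
      using K(1) by (simp add: Fock_inner_def norm_divide norm_mult)
  qed
  show ?thesis
    unfolding C K(2) [symmetric]
    using Sp2 K_sinh b_par_eq_exp [OF assms(1)] Fock norm c bargmann vacuum by blast
qed

end
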